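(* Let $\mathcal{L}$ be a Cameron-Liebler $k$-set in $\mathrm{AG}(n,q)$. Suppose now that $\pi$ is an $i$-dimensional subspace in $\mathrm{AG}(n,q)$, with $i\geq k+1$, then $\mathcal{L}\cap [\pi]_k$ is a Cameron-Liebler $k$-set in $\pi$.
   Context: A Cameron-Liebler $k$-set in $\mathrm{AG}(n,q)$ ($n\geq 2k+1$) is a set $\mathcal{L}$ of $k$-spaces whose characteristic vector lies in the row space of the point-($k$-space) incidence matrix of $\mathrm{AG}(n,q)$, equivalently a set of $k$-spaces meeting every $k$-spread (partition of the point set into $k$-spaces) in a constant number $x$ of elements; its parameter $x$ satisfies $|\mathcal{L}|=x\begin{bmatrix} n \\ k\end{bmatrix}_q$, with $\begin{bmatrix} b \\ a\end{bmatrix}_q=\frac{(q^b-1)\cdots(q^{b-a+1}-1)}{(q^a-1)\cdots(q-1)}$. $[\pi]_k$ denotes the set of $k$-spaces contained in $\pi$. *)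

theory Defs
  imports "HOL-Analysis.Analysis"
begin

text \<open>
  The points of \<open>AG(n,q)\<close> are the vectors of \<^typ>\<open>'a ^ 'n\<close>, where \<^typ>\<open>'a\<close> is a finite field,
  \<open>q = CARD('a)\<close> and \<open>n = CARD('n)\<close>; subspaces are identified with their point sets.
  The library's \<open>affine\<close> is available for real vector spaces only.
\<close>

definition affine_space :: "nat \<Rightarrow> ('a::field ^ 'n) set \<Rightarrow> bool" where
  "affine_space k S \<longleftrightarrow> (\<exists>a V. vec.subspace V \<and> vec.dim V = k \<and> S = (\<lambda>v. a + v) ` V)"

definition spaces_in :: "nat \<Rightarrow> ('a::field ^ 'n) set \<Rightarrow> ('a ^ 'n) set set" where
  "spaces_in k \<pi> = {K. affine_space k K \<and> K \<subseteq> \<pi>}"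

text \<open>
  The point-(\<open>k\<close>-space) incidence matrix of the affine space \<open>\<pi>\<close>. Rows are indexed by all
  points and columns by all sets of points of the ambient space; the rows of points outside \<open>\<pi>\<close> and
  the columns of sets that are not \<open>k\<close>-spaces in \<open>\<pi>\<close> are zero. This zero padding changes
  the row space only by appending zero coordinates to its vectors.
\<close>

definition incidence_matrix ::
    "nat \<Rightarrow> ('a::{field,finite} ^ 'n) set \<Rightarrow> real ^ (('a ^ 'n) set) ^ ('a ^ 'n)" where
  "incidence_matrix k \<pi> =
     (\<chi> p K. if p \<in> \<pi> \<and> K \<in> spaces_in k \<pi> \<and> p \<in> K then 1 else 0)"

definition characteristic_vector :: "'b::finite set \<Rightarrow> real ^ 'b" where
  "characteristic_vector L = (\<chi> K. if K \<in> L then 1 else 0)"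

text \<open>
  \<open>\<pi>\<close> is meant to be an affine space of any dimension; \<open>AG(n,q)\<close> itself is \<open>\<pi> = UNIV\<close>.
  No bound relating \<open>k\<close> and the dimension of \<open>\<pi>\<close> is built in.
\<close>

definition cameron_liebler ::
    "nat \<Rightarrow> ('a::{field,finite} ^ 'n) set \<Rightarrow> ('a ^ 'n) set set \<Rightarrow> bool" where
  "cameron_liebler k \<pi> L \<longleftrightarrow>
     L \<subseteq> spaces_in k \<pi> \<and> characteristic_vector L \<in> span (rows (incidence_matrix k \<pi>))"

end

theory Submission imports Defs begin

text \<open>
  Keeping only the coordinates indexed by the \<open>k\<close>-spaces of \<open>\<pi>\<close> is a linear map. It sends the row
  of a point of \<open>\<pi>\<close> to the row of that point in the incidence matrix of \<open>\<pi>\<close>, and the row of any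
  other point to \<open>0\<close>; hence it maps the one row space into the other.
\<close>

definition restrict_coords :: "'b::finite set \<Rightarrow> real ^ 'b \<Rightarrow> real ^ 'b" where
  "restrict_coords S v = (\<chi> j. if j \<in> S then v $ j else 0)"

lemma linear_restrict_coords: "linear (restrict_coords S)"
  by (rule linearI) (auto simp: restrict_coords_def vec_eq_iff)

lemma restrict_coords_characteristic_vector:
  "restrict_coords S (characteristic_vector L) = characteristic_vector (L \<inter> S)"
  by (auto simp: restrict_coords_def characteristic_vector_def vec_eq_iff)

text \<open>A \<open>k\<close>-space in \<pi> is also one in \<rho>, and every point on it lies in
  \<pi>. So both matrices agree in the retained columns, even in the row of a point outside \<pi>,
  where these entries are all 0.\<close>

lemma restrict_coords_row_incidence_matrix:
  assumes "\<pi> \<subseteq> \<rho>"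
  shows "restrict_coords (spaces_in k \<pi>) (row p (incidence_matrix k \<rho>)) = row p (incidence_matrix k \<pi>)"
  using assms
  by (auto simp: restrict_coords_def row_def incidence_matrix_def spaces_in_def vec_eq_iff)

lemma cameron_liebler_restrict:
  assumes "cameron_liebler k \<rho> L" and "\<pi> \<subseteq> \<rho>"
  shows "cameron_liebler k \<pi> (L \<inter> spaces_in k \<pi>)"
proof -
  let ?P = "restrict_coords (spaces_in k \<pi>)"
  \<comment> \<open>Both matrices have one row per ambient point, so their rows correspond point by
    point, zero rows included.\<close>
  have "?P ` rows (incidence_matrix k \<rho>) = rows (incidence_matrix k \<pi>)"
    using restrict_coords_row_incidence_matrix[OF assms(2)]
    by (auto simp: rows_def image_iff) metis+
  then have "?P ` span (rows (incidence_matrix k \<rho>)) = span (rows (incidence_matrix k \<pi>))"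
    by (metis linear_span_image linear_restrict_coords)
  moreover have "characteristic_vector L \<in> span (rows (incidence_matrix k \<rho>))"
    using assms(1) by (simp add: cameron_liebler_def)
  ultimately have "?P (characteristic_vector L) \<in> span (rows (incidence_matrix k \<pi>))"
    by blast
  then show ?thesis
    by (simp add: cameron_liebler_def restrict_coords_characteristic_vector)
qed

theorem theorem3p6:
  fixes k i :: nat
    and L :: "('a::{field,finite} ^ 'n) set set"
    and \<pi> :: "('a ^ 'n) set"
  assumes "CARD('n) \<ge> 2 * k + 1"
    and "cameron_liebler k UNIV L"
    and "affine_space i \<pi>"
    and "i \<ge> k + 1"
  shows "cameron_liebler k \<pi> (L \<inter> spaces_in k \<pi>)"
  using assms(2) subset_UNIV by (rule cameron_liebler_restrict)

end
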